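(* There is an absolute constant $C$ such that the following holds. Let $k\ge6$, $1\le d\le(k-1)/2$, and $\lambda=d/(k-1)$. Then for every $d$-regular graph $H$ on $k$ labelled vertices, $$1\;<\;F_{\mathrm{spec}}(H)\;\le\;\exp\Bigl(1+\frac{(1-\lambda)(1-2\lambda)^2}{4\lambda^3}+\frac{C}{\lambda^3k}\Bigr),$$ where $F_{\mathrm{spec}}(H)$ is evaluated at $\bar a=\lambda$ as defined in the context. In particular, for $\lambda\ge\lambda_0>0$ the quantity $F_{\mathrm{spec}}(H)$ is bounded by a constant depending only on $\lambda_0$, uniformly in $H$ and $k$.
   Context: For a $d$-regular graph $H$ on $k$ vertices let $\mu_2\ge\dots\ge\mu_k$ be the eigenvalues of its adjacency matrix $A_H$ on $\mathbf 1^\perp=\{y\in\mathbb R^k:\sum_i y_i=0\}$. With $\bar a=\lambda=d/(k-1)$ set, for $i=2,\dots,k$, $$q_i=\tfrac18\Bigl[\tfrac d{\bar a^2}+\tfrac{k-2-d}{(1-\bar a)^2}+\bigl(\tfrac1{\bar a^2}-\tfrac1{(1-\bar a)^2}\bigr)\mu_i\Bigr],\qquad I:=\frac{k}{8\lambda(1-\lambda)},\qquad F_{\mathrm{spec}}(H):=\prod_{i=2}^{k}\Bigl(\frac{I}{q_i}\Bigr)^{1/2}.$$ *)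

theory Defs
  imports Complex_Main "Jordan_Normal_Form.Char_Poly" "Jordan_Normal_Form.VS_Connect"
begin

(* A graph is given by its edge set; the labelled vertices are 0, ..., k - 1. *)

definition simple_graph :: "nat \<Rightarrow> nat set set \<Rightarrow> bool" where
  "simple_graph k E \<longleftrightarrow> (\<forall>e\<in>E. e \<subseteq> {..<k} \<and> card e = 2)"

definition regular_graph :: "nat \<Rightarrow> nat \<Rightarrow> nat set set \<Rightarrow> bool" where
  "regular_graph k d E \<longleftrightarrow> simple_graph k E \<and> (\<forall>v<k. card {e \<in> E. v \<in> e} = d)"

definition adj_mat :: "nat \<Rightarrow> nat set set \<Rightarrow> real mat" where
  "adj_mat k E = mat k k (\<lambda>(i, j). if {i, j} \<in> E then 1 else 0)"

definition ones_perp :: "nat \<Rightarrow> real vec set" where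
  "ones_perp k = {y \<in> carrier_vec k. (\<Sum>i<k. y $ i) = 0}"

definition perp_eigenvalues :: "nat \<Rightarrow> nat set set \<Rightarrow> real set" where
  "perp_eigenvalues k E = {\<mu>. \<exists>y\<in>ones_perp k. eigenvector (adj_mat k E) y \<mu>}"

definition perp_eigenspace :: "nat \<Rightarrow> nat set set \<Rightarrow> real \<Rightarrow> real vec set" where
  "perp_eigenspace k E \<mu> = {y \<in> ones_perp k. adj_mat k E *\<^sub>v y = \<mu> \<cdot>\<^sub>v y}"

definition perp_multiplicity :: "nat \<Rightarrow> nat set set \<Rightarrow> real \<Rightarrow> nat" where
  "perp_multiplicity k E \<mu> =
     vectorspace.dim class_ring (module_vec TYPE(real) k\<lparr>carrier := perp_eigenspace k E \<mu>\<rparr>)"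

(* The eigenvalues on ones_perp in decreasing order, each repeated according to its
   multiplicity. The adjacency matrix is symmetric, so geometric and algebraic multiplicities
   agree; for a regular graph with k > 0 the list has length k - 1. *)

definition perp_spectrum :: "nat \<Rightarrow> nat set set \<Rightarrow> real list" where
  "perp_spectrum k E =
     concat (map (\<lambda>\<mu>. replicate (perp_multiplicity k E \<mu>) \<mu>)
       (rev (sorted_list_of_set (perp_eigenvalues k E))))"

(* Indexed by i = 2, ..., k; the index 1 is reserved for the eigenvalue d on the constants. *)

definition mu :: "nat \<Rightarrow> nat set set \<Rightarrow> nat \<Rightarrow> real" where
  "mu k E i = perp_spectrum k E ! (i - 2)"

definition edge_density :: "nat \<Rightarrow> nat \<Rightarrow> real" where
  "edge_density k d = real d / (real k - 1)"

definition q_spec :: "nat \<Rightarrow> nat \<Rightarrow> nat set set \<Rightarrow> nat \<Rightarrow> real" where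
  "q_spec k d E i =
     (let a = edge_density k d in
        1 / 8 * (real d / a\<^sup>2 + (real k - 2 - real d) / (1 - a)\<^sup>2
                 + (1 / a\<^sup>2 - 1 / (1 - a)\<^sup>2) * mu k E i))"

definition I_spec :: "nat \<Rightarrow> nat \<Rightarrow> real" where
  "I_spec k d =
     (let l = edge_density k d in real k / (8 * l * (1 - l)))"

definition F_spec :: "nat \<Rightarrow> nat \<Rightarrow> nat set set \<Rightarrow> real" where
  "F_spec k d E = (\<Prod>i = 2..k. (I_spec k d / q_spec k d E i) powr (1 / 2))"

end

theory Submission
  imports Defs "Jordan_Normal_Form.Jordan_Normal_Form_Uniqueness"
    "Jordan_Normal_Form.Jordan_Normal_Form_Existence"
begin

text \<open>
  Write \<open>\<lambda> = d / (k - 1)\<close> and \<open>q\<^sub>i / I = 1 + x\<^sub>i\<close>, where \<open>x\<^sub>i\<close> is an affine function of \<open>\<mu>\<^sub>i\<close>.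
  Then \<open>ln F\<close> is \<open>- 1/2\<close> times the sum of the \<open>ln (1 + x\<^sub>i)\<close>, and everything about the
  graph that matters is contained in three facts about its eigenvalues on \<open>1\<^sup>\<bottom>\<close>: their sum
  is \<open>- d\<close>, the sum of their squares is \<open>d (k - d)\<close>, and each is at least \<open>- d\<close>.

  The first fact makes the sum of the \<open>x\<^sub>i\<close> equal to \<open>- 2 (k - 1) / k\<close>, whatever the graph. As
  \<open>ln (1 + x) \<le> x\<close>, this already gives \<open>ln F \<ge> (k - 1) / k > 0\<close>. The third fact gives
  \<open>1 + x\<^sub>i \<ge> m\<close> for a constant \<open>m\<close> close to \<open>\<lambda> / (1 - \<lambda>)\<close>, and above \<open>m\<close> the logarithm obeys
  \<open>ln (1 + x) \<ge> x - x\<^sup>2 / (2 m)\<close> (\<open>ln_quadratic_lower_bound\<close>). Hence \<open>ln F\<close> is at most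
  \<open>(k - 1) / k\<close> plus the sum of the \<open>x\<^sub>i\<^sup>2\<close> divided by \<open>4 m\<close>, and the first two facts evaluate that
  sum exactly (\<open>rel_q_deviation_moments\<close>). The result is
  \<open>1 + (1 - 2 \<lambda>)\<^sup>2 / (4 \<lambda>\<^sup>2) + O(1 / (\<lambda>\<^sup>2 k))\<close>; the stated bound is weaker by the factor
  \<open>(1 - \<lambda>) / \<lambda> \<ge> 1\<close> in the middle term, and it holds with \<open>C = 1\<close>.

  The spectral facts are trace identities, but the eigenvalues are given as a list built from
  the dimensions of the eigenspaces inside \<open>1\<^sup>\<bottom>\<close>. To connect the two, replace the adjacency matrix
  \<open>A\<close> by \<open>B = A + J / k\<close>, with \<open>J\<close> the all-ones matrix. On \<open>1\<^sup>\<bottom>\<close> the two agree, while the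
  eigenvalue of the constants moves from \<open>d\<close> to \<open>d + 1\<close>. That value lies beyond every eigenvalue
  of \<open>A\<close>, so it is a simple eigenvalue of \<open>B\<close>, even if the graph is disconnected, and each other
  eigenspace of \<open>B\<close> is an eigenspace of \<open>A\<close> in \<open>1\<^sup>\<bottom>\<close>. By diagonalizability of real
  symmetric matrices, the list of interest together with \<open>d + 1\<close> is then the full spectrum of \<open>B\<close>, and the
  traces of \<open>B\<close> and \<open>B\<^sup>2\<close> give the two sums.
\<close>

section \<open>Diagonalization of real symmetric matrices\<close>

text \<open>
  For an eigenvector \<open>v\<close>, both \<open>v\<^sup>* A v\<close> and \<open>v\<^sup>* v \<noteq> 0\<close> are real, and \<open>a\<close> is their quotient.
\<close>

lemma symmetric_real_complex_eigenvalue_real: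
  fixes A :: "real mat"
  assumes A: "A \<in> carrier_mat n n"
    and sym: "\<And>i j. i < n \<Longrightarrow> j < n \<Longrightarrow> A $$ (i, j) = A $$ (j, i)"
    and ev: "eigenvalue (map_mat complex_of_real A) a"
  shows "a \<in> \<real>"
proof -
  from ev A obtain v where v: "v \<in> carrier_vec n" "v \<noteq> 0\<^sub>v n"
    and Av: "map_mat complex_of_real A *\<^sub>v v = a \<cdot>\<^sub>v v"
    unfolding eigenvalue_def eigenvector_def by auto
  define S where "S = (\<Sum>i<n. \<Sum>j<n. of_real (A $$ (i, j)) * v $ j * cnj (v $ i))"
  define N where "N = (\<Sum>i<n. (cmod (v $ i))\<^sup>2)"
  have row: "(\<Sum>j<n. of_real (A $$ (i, j)) * v $ j) = a * v $ i" if "i < n" for i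
  proof -
    have "(map_mat complex_of_real A *\<^sub>v v) $ i = (\<Sum>j<n. of_real (A $$ (i, j)) * v $ j)"
      using A v(1) that by (simp add: scalar_prod_def lessThan_atLeast0)
    thus ?thesis unfolding Av using v(1) that by simp
  qed
  have "S = (\<Sum>i<n. a * v $ i * cnj (v $ i))"
    unfolding S_def by (rule sum.cong) (auto simp: sum_distrib_right[symmetric] row)
  also have "\<dots> = a * of_real N"
    by (simp add: N_def sum_distrib_left mult.assoc complex_norm_square del: of_real_power)
  finally have SN: "S = a * of_real N" .
  have "cnj S = (\<Sum>i<n. \<Sum>j<n. of_real (A $$ (i, j)) * cnj (v $ j) * v $ i)"
    by (simp add: S_def)
  also have "\<dots> = (\<Sum>j<n. \<Sum>i<n. of_real (A $$ (i, j)) * cnj (v $ j) * v $ i)"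
    by (rule sum.swap)
  also have "\<dots> = S"
    unfolding S_def by (intro sum.cong refl) (auto simp: sym mult_ac)
  finally have "S \<in> \<real>" by (simp add: Reals_cnj_iff)
  moreover have "N \<noteq> 0"
  proof
    assume "N = 0"
    hence "\<forall>i<n. v $ i = 0" by (auto simp: N_def sum_nonneg_eq_0_iff)
    hence "v = 0\<^sub>v n" using v(1) by (intro eq_vecI) auto
    with v(2) show False by simp
  qed
  ultimately show ?thesis
    unfolding SN by (metis Reals_divide Reals_of_real nonzero_mult_div_cancel_right of_real_eq_0_iff)
qed

lemma symmetric_real_char_poly_splits:
  fixes A :: "real mat"
  assumes A: "A \<in> carrier_mat n n"
    and sym: "\<And>i j. i < n \<Longrightarrow> j < n \<Longrightarrow> A $$ (i, j) = A $$ (j, i)"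
  shows "\<exists>bs. char_poly A = (\<Prod>b\<leftarrow>bs. [:- b, 1:])"
proof -
  interpret poly_hom: map_poly_inj_idom_hom complex_of_real ..
  let ?C = "map_mat complex_of_real A"
  have C: "?C \<in> carrier_mat n n" using A by simp
  from char_poly_factorized[OF C] obtain as where
    as: "char_poly ?C = (\<Prod>a\<leftarrow>as. [:- a, 1:])" by blast
  have real: "a \<in> \<real>" if "a \<in> set as" for a
  proof -
    have "poly (char_poly ?C) a = 0"
      using that unfolding as poly_prod_list by auto
    hence "eigenvalue ?C a" using eigenvalue_root_char_poly[OF C] by simp
    thus ?thesis using symmetric_real_complex_eigenvalue_real[OF A sym] by blast
  qed
  have "map_poly complex_of_real (char_poly A) = (\<Prod>a\<leftarrow>as. [:- a, 1:])"
    by (rule trans[OF of_real_hom.char_poly_hom[OF A, symmetric] as])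
  also have "\<dots> = (\<Prod>a\<leftarrow>as. map_poly complex_of_real [:- Re a, 1:])"
    using real by (intro arg_cong[where f = prod_list] map_cong refl) simp
  also have "\<dots> = map_poly complex_of_real (\<Prod>b\<leftarrow>map Re as. [:- b, 1:])"
    by (simp add: poly_hom.hom_prod_list o_def)
  finally have "char_poly A = (\<Prod>b\<leftarrow>map Re as. [:- b, 1:])" by simp
  thus ?thesis by blast
qed

text \<open>
  If \<open>B\<^sup>2 v = 0\<close>, then \<open>|B v|\<^sup>2 = v \<bullet> B\<^sup>2 v = 0\<close>. This is what excludes nontrivial Jordan blocks.
\<close>

lemma symmetric_mat_kernel_square:
  fixes B :: "real mat"
  assumes B: "B \<in> carrier_mat n n"
    and sym: "\<And>i j. i < n \<Longrightarrow> j < n \<Longrightarrow> B $$ (i, j) = B $$ (j, i)"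
  shows "mat_kernel (B * B) = mat_kernel B"
proof -
  have tr: "transpose_mat B = B" using B sym by (intro eq_matI) auto
  have "B *\<^sub>v v = 0\<^sub>v n" if v: "v \<in> carrier_vec n" and z: "(B * B) *\<^sub>v v = 0\<^sub>v n" for v
  proof -
    have Bv: "B *\<^sub>v v \<in> carrier_vec n" using B v by auto
    have "(B *\<^sub>v v) \<bullet> (B *\<^sub>v v) = v \<bullet> (B *\<^sub>v (B *\<^sub>v v))"
      using transpose_vec_mult_scalar[OF B v Bv] comm_scalar_prod[OF v, of "B *\<^sub>v (B *\<^sub>v v)"] B Bv
      unfolding tr by simp
    also have "B *\<^sub>v (B *\<^sub>v v) = 0\<^sub>v n" using z B v by simp
    finally have "(B *\<^sub>v v) \<bullet>c (B *\<^sub>v v) = 0" using v by simp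
    thus ?thesis using conjugate_square_eq_0_vec[OF Bv] by simp
  qed
  moreover have "(B * B) *\<^sub>v v = 0\<^sub>v n" if v: "v \<in> carrier_vec n" and z: "B *\<^sub>v v = 0\<^sub>v n" for v
    using B v z by auto
  ultimately show ?thesis using B unfolding mat_kernel_def by auto
qed

text \<open>
  Diagonalizability is expressed by a Jordan normal form all of whose blocks have size 1, because
  the known formula for kernel dimensions in terms of Jordan blocks then yields the
  multiplicities. A larger block for \<open>e\<close> would make the kernel of \<open>(A - e)\<^sup>2\<close> larger than that of
  \<open>A - e\<close>.
\<close>

lemma symmetric_real_diagonalizable:
  fixes A :: "real mat"
  assumes A: "A \<in> carrier_mat n n"
    and sym: "\<And>i j. i < n \<Longrightarrow> j < n \<Longrightarrow> A $$ (i, j) = A $$ (j, i)"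
  shows "\<exists>bs. jordan_nf A (map (Pair 1) bs)"
proof -
  from symmetric_real_char_poly_splits[OF A sym] jordan_nf_exists[OF A]
  obtain n_as where jnf: "jordan_nf A n_as" by blast
  have "m = 1" if mem: "(m, e) \<in> set n_as" for m e
  proof (rule ccontr)
    assume "m \<noteq> 1"
    moreover have "m \<noteq> 0" using jnf mem unfolding jordan_nf_def by force
    ultimately have m: "2 \<le> m" by auto
    let ?B = "char_matrix A e"
    have B: "?B \<in> carrier_mat n n" using A by simp
    have "mat_kernel (?B * ?B) = mat_kernel ?B"
      by (rule symmetric_mat_kernel_square[OF B]) (use A sym in \<open>auto simp: char_matrix_def\<close>)
    hence "dim_gen_eigenspace A e 2 = dim_gen_eigenspace A e 1"
      using B by (simp add: dim_gen_eigenspace_def kernel_dim_def numeral_2_eq_2)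
    moreover obtain as bs where nas: "n_as = as @ (m, e) # bs"
      using mem by (meson split_list)
    \<comment> \<open>The blocks other than \<open>(m, e)\<close> contribute at least as much to the dimension for the square.\<close>
    have le: "sum_list (map (min 1) ms) \<le> sum_list (map (min (2::nat)) ms)" for ms
      by (rule sum_list_mono) auto
    have "dim_gen_eigenspace A e 1 < dim_gen_eigenspace A e 2"
      unfolding dim_gen_eigenspace[OF jnf] nas using m
        le[of "map fst [(n, e')\<leftarrow>as . e' = e]"] le[of "map fst [(n, e')\<leftarrow>bs . e' = e]"]
      by (simp add: add_mono_thms_linordered_field o_def)
    ultimately show False by simp
  qed
  hence "n_as = map (Pair 1) (map snd n_as)"
    by (intro nth_equalityI) (auto simp: prod_eq_iff, metis nth_mem prod.collapse)
  thus ?thesis using jnf by metis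
qed

lemma diagonalizable_dim_eigenspace:
  fixes A :: "real mat"
  assumes "jordan_nf A (map (Pair 1) bs)"
  shows "kernel_dim (char_matrix A \<mu>) = count (mset bs) \<mu>"
proof -
  from assms obtain n where "A \<in> carrier_mat n n"
    unfolding jordan_nf_def by (blast dest: similar_matD)
  hence car: "char_matrix A \<mu> \<in> carrier_mat n n" by simp
  have "kernel_dim (char_matrix A \<mu>) = dim_gen_eigenspace A \<mu> 1"
    using car by (simp add: dim_gen_eigenspace_def)
  also have "\<dots> = count (mset bs) \<mu>"
    unfolding dim_gen_eigenspace[OF assms] by (induction bs) auto
  finally show ?thesis .
qed

lemma diagonalizable_eigenvalue_iff:
  fixes A :: "real mat"
  assumes A: "A \<in> carrier_mat n n" and jnf: "jordan_nf A (map (Pair 1) bs)"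
  shows "eigenvalue A \<mu> \<longleftrightarrow> \<mu> \<in> set bs"
proof -
  have "char_poly A = (\<Prod>b\<leftarrow>bs. [:- b, 1:])"
    using jordan_nf_char_poly[OF jnf] by (simp add: o_def)
  moreover have "poly (\<Prod>b\<leftarrow>bs. [:- b, 1:]) \<mu> = 0 \<longleftrightarrow> \<mu> \<in> set bs"
    by (induction bs) auto
  ultimately show ?thesis
    unfolding eigenvalue_root_char_poly[OF A] by simp
qed

section \<open>Traces and power sums of eigenvalues\<close>

definition mat_trace :: "'a::comm_monoid_add mat \<Rightarrow> 'a" where
  "mat_trace A = (\<Sum>i<dim_row A. A $$ (i, i))"

lemma mat_trace_mult_commute:
  fixes A B :: "'a::comm_semiring_0 mat"
  assumes "A \<in> carrier_mat n m" "B \<in> carrier_mat m n"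
  shows "mat_trace (A * B) = mat_trace (B * A)"
proof -
  have "mat_trace (A * B) = (\<Sum>i<n. \<Sum>j<m. A $$ (i, j) * B $$ (j, i))"
    using assms by (simp add: mat_trace_def scalar_prod_def lessThan_atLeast0)
  also have "\<dots> = (\<Sum>j<m. \<Sum>i<n. A $$ (i, j) * B $$ (j, i))" by (rule sum.swap)
  also have "\<dots> = mat_trace (B * A)"
    using assms by (simp add: mat_trace_def scalar_prod_def lessThan_atLeast0 mult.commute)
  finally show ?thesis .
qed

lemma mat_trace_similar:
  fixes A B :: "'a::comm_semiring_1 mat"
  assumes "similar_mat_wit A B P Q"
  shows "mat_trace A = mat_trace B"
proof -
  define n where "n = dim_row A"
  from similar_mat_witD[OF n_def assms] have
    c: "A \<in> carrier_mat n n" "B \<in> carrier_mat n n" "P \<in> carrier_mat n n" "Q \<in> carrier_mat n n"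
    and QP: "Q * P = 1\<^sub>m n" and AB: "A = P * B * Q" by auto
  have "mat_trace A = mat_trace (Q * (P * B))"
    unfolding AB using c by (intro mat_trace_mult_commute) auto
  also have "Q * (P * B) = (Q * P) * B" using c by (intro assoc_mult_mat[symmetric]) auto
  also have "\<dots> = B" using c QP by simp
  finally show ?thesis .
qed

lemma jordan_matrix_diagonal:
  "jordan_matrix (map (Pair 1) bs) = mat_diag (length bs) (\<lambda>i. bs ! i)"
proof (induction bs)
  case Nil
  show ?case by (rule eq_matI) (auto simp: mat_diag_def)
next
  case (Cons b bs)
  have len: "sum_list (map fst (map (Pair (1::nat)) bs)) = length bs"
    by (induction bs) auto
  show ?case
    unfolding list.map jordan_matrix_Cons Cons len[unfolded list.map]
  proof (rule eq_matI)
    fix i j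
    assume "i < dim_row (mat_diag (length (b # bs)) ((!) (b # bs)))"
      "j < dim_col (mat_diag (length (b # bs)) ((!) (b # bs)))"
    hence "i < Suc (length bs)" "j < Suc (length bs)" by (auto simp: mat_diag_def)
    thus "four_block_mat (jordan_block 1 b) (0\<^sub>m 1 (length bs)) (0\<^sub>m (length bs) 1)
        (mat_diag (length bs) ((!) bs)) $$ (i, j) = mat_diag (length (b # bs)) ((!) (b # bs)) $$ (i, j)"
      by (cases i; cases j) (auto simp: mat_diag_def jordan_block_def)
  qed (auto simp: mat_diag_def)
qed

lemma diagonalizable_power_sums:
  fixes A :: "real mat"
  assumes A: "A \<in> carrier_mat n n" and jnf: "jordan_nf A (map (Pair 1) bs)"
  shows "length bs = n" "sum_list bs = mat_trace A" "(\<Sum>b\<leftarrow>bs. b\<^sup>2) = mat_trace (A * A)"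
proof -
  let ?D = "mat_diag (length bs) (\<lambda>i. bs ! i)"
  from jnf obtain P Q where wit: "similar_mat_wit A ?D P Q"
    unfolding jordan_nf_def similar_mat_def jordan_matrix_diagonal by auto
  have "?D \<in> carrier_mat n n" using similar_mat_witD2[OF A wit] by blast
  thus len: "length bs = n" unfolding mat_diag_def carrier_mat_def by simp
  show "sum_list bs = mat_trace A"
    unfolding mat_trace_similar[OF wit]
    by (simp add: mat_trace_def mat_diag_def sum_list_sum_nth lessThan_atLeast0)
  have "similar_mat_wit (A ^\<^sub>m 2) (?D ^\<^sub>m 2) P Q" by (rule similar_mat_wit_pow[OF wit])
  hence "mat_trace (A * A) = mat_trace (?D * ?D)"
    using mat_trace_similar A by (fastforce simp: numeral_2_eq_2)
  also have "\<dots> = (\<Sum>b\<leftarrow>bs. b\<^sup>2)"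
    by (simp add: mat_trace_def mat_diag_diag, simp add: mat_diag_def sum_list_sum_nth lessThan_atLeast0 power2_eq_square)
  finally show "(\<Sum>b\<leftarrow>bs. b\<^sup>2) = mat_trace (A * A)" by simp
qed

section \<open>The spectrum of a regular graph on the complement of the constants\<close>

lemma kernel_dim_eq_1I:
  fixes A :: "'a::field mat"
  assumes A: "A \<in> carrier_mat n m" and v: "v \<in> mat_kernel A" "v \<noteq> 0\<^sub>v m"
    and gen: "\<And>w. w \<in> mat_kernel A \<Longrightarrow> \<exists>c. w = c \<cdot>\<^sub>v v"
  shows "kernel_dim A = 1"
proof -
  interpret kernel n m A by unfold_locales (rule A)
  have v': "v \<in> carrier_vec m" using v(1) A mat_kernel by blast
  have "w \<in> span {v}" if w: "w \<in> mat_kernel A" for w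
  proof -
    from gen[OF w] obtain c where c: "w = c \<cdot>\<^sub>v v" by blast
    have "w = lincomb (\<lambda>_. c) {v}"
    proof (rule eq_vecI)
      have "lincomb (\<lambda>_. c) {v} \<in> mat_kernel A" using v(1) by (intro Ker.lincomb_closed) auto
      hence "lincomb (\<lambda>_. c) {v} \<in> carrier_vec m" using A mat_kernel by blast
      thus "dim_vec w = dim_vec (lincomb (\<lambda>_. c) {v})" using c v' by simp
      thus "w $ i = lincomb (\<lambda>_. c) {v} $ i" if "i < dim_vec (lincomb (\<lambda>_. c) {v})" for i
        using that c v v' by (subst lincomb_index) auto
    qed
    thus ?thesis unfolding Ker.span_def by blast
  qed
  moreover have "span {v} \<subseteq> mat_kernel A" using v(1) Ker.span_is_subset2[of "{v}"] by simp
  ultimately have "gen_set {v}" by auto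
  hence "dim = 1" using v by (intro Ker.dim1I) auto
  thus ?thesis by simp
qed

lemma mat_kernel_char_matrix:
  fixes A :: "'a::field mat"
  assumes A: "A \<in> carrier_mat n n"
  shows "mat_kernel (char_matrix A \<mu>) = {v \<in> carrier_vec n. A *\<^sub>v v = \<mu> \<cdot>\<^sub>v v}"
proof -
  have "char_matrix A \<mu> *\<^sub>v v = 0\<^sub>v n \<longleftrightarrow> A *\<^sub>v v = \<mu> \<cdot>\<^sub>v v" if v: "v \<in> carrier_vec n" for v
  proof (cases "v = 0\<^sub>v n")
    case True
    thus ?thesis using A by (auto simp: char_matrix_def)
  next
    case False
    thus ?thesis using eigenvector_char_matrix[OF A, of v \<mu>] v A by (auto simp: eigenvector_def)
  qed
  moreover have "char_matrix A \<mu> \<in> carrier_mat n n" using A by simp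
  ultimately show ?thesis unfolding mat_kernel_def carrier_mat_def by auto
qed

lemma regular_graph_row_sum:
  assumes G: "regular_graph k d E" and i: "i < k"
  shows "(\<Sum>j<k. if {i, j} \<in> E then 1 else 0) = real d"
proof -
  have E: "e \<subseteq> {..<k}" "card e = 2" if "e \<in> E" for e
    using G that unfolding regular_graph_def simple_graph_def by auto
  have "bij_betw (\<lambda>j. {i, j}) {j. j < k \<and> {i, j} \<in> E} {e \<in> E. i \<in> e}"
    unfolding bij_betw_def
  proof
    show "inj_on (\<lambda>j. {i, j}) {j. j < k \<and> {i, j} \<in> E}"
      by (auto simp: inj_on_def doubleton_eq_iff)
    have "e \<in> (\<lambda>j. {i, j}) ` {j. j < k \<and> {i, j} \<in> E}" if e: "e \<in> E" "i \<in> e" for e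
    proof -
      from E(2)[OF e(1)] obtain x y where "e = {x, y}" by (meson card_2_iff)
      with e(2) obtain j where "e = {i, j}" by auto
      thus ?thesis using e E(1)[OF e(1)] by auto
    qed
    thus "(\<lambda>j. {i, j}) ` {j. j < k \<and> {i, j} \<in> E} = {e \<in> E. i \<in> e}" by auto
  qed
  from bij_betw_same_card[OF this] have "card {j. j < k \<and> {i, j} \<in> E} = d"
    using G i by (simp add: regular_graph_def)
  moreover have "(\<Sum>j<k. if {i, j} \<in> E then 1 else 0) = (\<Sum>j\<in>{j \<in> {..<k}. {i, j} \<in> E}. 1::real)"
    by (rule sum.inter_filter[symmetric]) (rule finite_lessThan)
  moreover have "{j \<in> {..<k}. {i, j} \<in> E} = {j. j < k \<and> {i, j} \<in> E}" by auto
  ultimately show ?thesis by (simp only: sum_constant mult_1_right)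
qed

lemma adj_mat_mult_index:
  assumes "y \<in> carrier_vec k" "i < k"
  shows "(adj_mat k E *\<^sub>v y) $ i = (\<Sum>j<k. (if {i, j} \<in> E then 1 else 0) * y $ j)"
  using assms unfolding lessThan_atLeast0 by (simp add: adj_mat_def scalar_prod_def row_def)

lemma regular_graph_column_sum:
  assumes G: "regular_graph k d E" and j: "j < k"
  shows "(\<Sum>i<k. if {i, j} \<in> E then 1 else 0) = real d"
  using regular_graph_row_sum[OF G j] by (subst insert_commute)

text \<open>
  Compare both sides of \<open>A y = \<mu> y\<close> at a vertex where \<open>|y|\<close> is maximal.
\<close>

lemma regular_graph_eigenvalue_bound:
  assumes G: "regular_graph k d E" and ev: "eigenvector (adj_mat k E) y \<mu>"
  shows "\<bar>\<mu>\<bar> \<le> real d"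
proof -
  have y: "y \<in> carrier_vec k" "y \<noteq> 0\<^sub>v k" and Ay: "adj_mat k E *\<^sub>v y = \<mu> \<cdot>\<^sub>v y"
    using ev unfolding eigenvector_def adj_mat_def by auto
  from y obtain i0 where i0: "i0 < k" "y $ i0 \<noteq> 0"
    by (metis carrier_vecD eq_vecI index_zero_vec)
  define M where "M = Max ((\<lambda>i. \<bar>y $ i\<bar>) ` {..<k})"
  have M: "\<bar>y $ i\<bar> \<le> M" if "i < k" for i
    unfolding M_def using that by (intro Max_ge) auto
  have "M \<in> (\<lambda>i. \<bar>y $ i\<bar>) ` {..<k}"
    unfolding M_def using i0 by (intro Max_in) auto
  then obtain i where i: "i < k" "M = \<bar>y $ i\<bar>" by auto
  have "\<bar>\<mu>\<bar> * M = \<bar>(adj_mat k E *\<^sub>v y) $ i\<bar>"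
    unfolding Ay using i y by (simp add: abs_mult)
  also have "\<dots> \<le> (\<Sum>j<k. \<bar>(if {i, j} \<in> E then 1 else 0) * y $ j\<bar>)"
    unfolding adj_mat_mult_index[OF y(1) i(1)] by (rule sum_abs)
  also have "\<dots> \<le> (\<Sum>j<k. (if {i, j} \<in> E then 1 else 0) * M)"
    using M by (intro sum_mono) (auto simp: abs_mult)
  also have "\<dots> = real d * M"
    by (simp only: sum_distrib_right[symmetric] regular_graph_row_sum[OF G i(1)])
  finally have "\<bar>\<mu>\<bar> * M \<le> real d * M" .
  moreover have "M > 0" using M[OF i0(1)] i0(2) by linarith
  ultimately show ?thesis by simp
qed

text \<open>
  Adding \<open>J / k\<close> separates the eigenvalue of the constants from the rest of the spectrum without
  changing the action on \<open>1\<^sup>\<bottom>\<close>.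
\<close>

definition shifted_adj_mat :: "nat \<Rightarrow> nat set set \<Rightarrow> real mat" where
  "shifted_adj_mat k E = mat k k (\<lambda>(i, j). (if {i, j} \<in> E then 1 else 0) + 1 / real k)"

lemma shifted_adj_mat_carrier: "shifted_adj_mat k E \<in> carrier_mat k k"
  by (simp add: shifted_adj_mat_def)

lemma shifted_adj_mat_mult_index:
  assumes "y \<in> carrier_vec k" "i < k"
  shows "(shifted_adj_mat k E *\<^sub>v y) $ i = (adj_mat k E *\<^sub>v y) $ i + (\<Sum>j<k. y $ j) / real k"
  unfolding adj_mat_mult_index[OF assms] using assms unfolding lessThan_atLeast0
  by (simp add: shifted_adj_mat_def scalar_prod_def row_def distrib_right sum.distrib sum_divide_distrib)

lemma shifted_adj_mat_mult_sum:
  assumes G: "regular_graph k d E" and k: "k > 0" and y: "y \<in> carrier_vec k"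
  shows "(\<Sum>i<k. (shifted_adj_mat k E *\<^sub>v y) $ i) = (real d + 1) * (\<Sum>i<k. y $ i)"
proof -
  have "(\<Sum>i<k. (adj_mat k E *\<^sub>v y) $ i) = (\<Sum>i<k. \<Sum>j<k. (if {i, j} \<in> E then 1 else 0) * y $ j)"
    by (simp add: adj_mat_mult_index[OF y])
  also have "\<dots> = (\<Sum>j<k. \<Sum>i<k. (if {i, j} \<in> E then 1 else 0) * y $ j)" by (rule sum.swap)
  also have "\<dots> = (\<Sum>j<k. real d * y $ j)"
    by (intro sum.cong refl) (simp only: sum_distrib_right[symmetric] regular_graph_column_sum[OF G] lessThan_iff)
  finally show ?thesis
    using k by (simp add: shifted_adj_mat_mult_index[OF y] sum.distrib sum_distrib_left[symmetric] distrib_right)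
qed

text \<open>
  Summing the coordinates of \<open>B y = \<mu> y\<close> gives \<open>(d + 1) \<Sum>y = \<mu> \<Sum>y\<close>, so an eigenvector of \<open>B\<close> for
  \<open>\<mu> \<noteq> d + 1\<close> lies in \<open>1\<^sup>\<bottom>\<close>, where \<open>B\<close> and the adjacency matrix agree.
\<close>

lemma perp_eigenspace_shifted:
  assumes G: "regular_graph k d E" and k: "k > 0" and \<mu>: "\<mu> \<noteq> real d + 1"
  shows "perp_eigenspace k E \<mu> = mat_kernel (char_matrix (shifted_adj_mat k E) \<mu>)"
proof -
  have "y \<in> perp_eigenspace k E \<mu> \<longleftrightarrow> shifted_adj_mat k E *\<^sub>v y = \<mu> \<cdot>\<^sub>v y"
    if y: "y \<in> carrier_vec k" for y
  proof -
    have eq: "shifted_adj_mat k E *\<^sub>v y = adj_mat k E *\<^sub>v y" if "(\<Sum>i<k. y $ i) = 0"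
      by (rule eq_vecI) (use that shifted_adj_mat_mult_index[OF y] in \<open>auto simp: adj_mat_def shifted_adj_mat_def\<close>)
    have "(\<Sum>i<k. y $ i) = 0" if "shifted_adj_mat k E *\<^sub>v y = \<mu> \<cdot>\<^sub>v y"
    proof -
      have "(\<Sum>i<k. (\<mu> \<cdot>\<^sub>v y) $ i) = (real d + 1) * (\<Sum>i<k. y $ i)"
        using shifted_adj_mat_mult_sum[OF G k y] that by simp
      hence "\<mu> * (\<Sum>i<k. y $ i) = (real d + 1) * (\<Sum>i<k. y $ i)"
        using y by (simp add: sum_distrib_left)
      thus ?thesis using \<mu> by simp
    qed
    thus ?thesis using y eq by (auto simp: perp_eigenspace_def ones_perp_def)
  qed
  moreover have "perp_eigenspace k E \<mu> \<subseteq> carrier_vec k"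
    by (auto simp: perp_eigenspace_def ones_perp_def)
  ultimately show ?thesis
    unfolding mat_kernel_char_matrix[OF shifted_adj_mat_carrier] by blast
qed

text \<open>
  Subtract from an eigenvector its mean. What remains lies in \<open>1\<^sup>\<bottom>\<close> and would be an eigenvector
  of the adjacency matrix for \<open>d + 1\<close>, which exceeds the bound \<open>d\<close> on its eigenvalues, unless it
  vanishes.
\<close>

lemma top_eigenspace_shifted:
  assumes G: "regular_graph k d E" and k: "k > 0"
  shows "kernel_dim (char_matrix (shifted_adj_mat k E) (real d + 1)) = 1"
proof (rule kernel_dim_eq_1I)
  let ?B = "shifted_adj_mat k E"
  let ?v = "vec k (\<lambda>_. 1::real)"
  note ker = mat_kernel_char_matrix[OF shifted_adj_mat_carrier]
  show "char_matrix ?B (real d + 1) \<in> carrier_mat k k"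
    using shifted_adj_mat_carrier by simp
  have Bv: "?B *\<^sub>v ?v = (real d + 1) \<cdot>\<^sub>v ?v"
  proof (rule eq_vecI)
    fix i assume "i < dim_vec ((real d + 1) \<cdot>\<^sub>v ?v)"
    hence i: "i < k" by simp
    show "(?B *\<^sub>v ?v) $ i = ((real d + 1) \<cdot>\<^sub>v ?v) $ i"
      using i k regular_graph_row_sum[OF G i]
      by (simp add: shifted_adj_mat_mult_index adj_mat_mult_index)
  qed (auto simp: shifted_adj_mat_def)
  thus "?v \<in> mat_kernel (char_matrix ?B (real d + 1))" unfolding ker by simp
  show "?v \<noteq> 0\<^sub>v k"
  proof
    assume "?v = 0\<^sub>v k"
    hence "?v $ 0 = 0\<^sub>v k $ 0" by simp
    thus False using k by simp
  qed
  fix w assume "w \<in> mat_kernel (char_matrix ?B (real d + 1))"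
  hence w: "w \<in> carrier_vec k" and Bw: "?B *\<^sub>v w = (real d + 1) \<cdot>\<^sub>v w" unfolding ker by auto
  define c where "c = (\<Sum>i<k. w $ i) / real k"
  define z where "z = w - c \<cdot>\<^sub>v ?v"
  have z: "z \<in> carrier_vec k" unfolding z_def using w by auto
  have zi: "z $ i = w $ i - c" if "i < k" for i unfolding z_def using w that by simp
  have z0: "(\<Sum>i<k. z $ i) = 0"
    using k by (simp add: zi sum_subtractf c_def)
  have Bz: "?B *\<^sub>v z = (real d + 1) \<cdot>\<^sub>v z"
  proof -
    have "?B *\<^sub>v z = ?B *\<^sub>v w - ?B *\<^sub>v (c \<cdot>\<^sub>v ?v)"
      unfolding z_def by (rule mult_minus_distrib_mat_vec[OF shifted_adj_mat_carrier w]) simp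
    also have "?B *\<^sub>v (c \<cdot>\<^sub>v ?v) = c \<cdot>\<^sub>v ((real d + 1) \<cdot>\<^sub>v ?v)"
      by (subst mult_mat_vec[OF shifted_adj_mat_carrier]) (auto simp: Bv)
    finally show ?thesis
      unfolding Bw z_def using w by (intro eq_vecI) (auto simp: algebra_simps)
  qed
  have Az: "adj_mat k E *\<^sub>v z = (real d + 1) \<cdot>\<^sub>v z"
    unfolding Bz[symmetric]
    by (rule eq_vecI) (use z0 shifted_adj_mat_mult_index[OF z] in \<open>auto simp: adj_mat_def shifted_adj_mat_def\<close>)
  have "z = 0\<^sub>v k"
  proof (rule ccontr)
    assume "z \<noteq> 0\<^sub>v k"
    hence "eigenvector (adj_mat k E) z (real d + 1)"
      using z Az by (simp add: eigenvector_def adj_mat_def)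
    from regular_graph_eigenvalue_bound[OF G this] show False by simp
  qed
  hence "w $ i = c" if "i < k" for i using zi[OF that] that by simp
  hence "w = c \<cdot>\<^sub>v ?v" using w by (intro eq_vecI) auto
  thus "\<exists>c. w = c \<cdot>\<^sub>v ?v" by blast
qed

lemma count_concat_replicate:
  assumes "distinct xs"
  shows "count (mset (concat (map (\<lambda>x. replicate (f x) x) xs))) x = (if x \<in> set xs then f x else 0)"
  using assms by (induction xs) auto

text \<open>
  The eigenvalues \<open>bs\<close> of the shifted matrix are \<open>d + 1\<close> followed by the list in question,
  since all multiplicities agree. The traces of the shifted matrix and of its square, read off from
  the entries, are \<open>1\<close> and \<open>k d + 2 d + 1\<close>; removing the contributions \<open>d + 1\<close> and
  \<open>(d + 1)\<^sup>2\<close> leaves the power sums.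
\<close>

lemma regular_graph_perp_spectrum:
  assumes G: "regular_graph k d E" and k: "k > 0"
  shows "length (perp_spectrum k E) = k - 1"
    and "sum_list (perp_spectrum k E) = - real d"
    and "(\<Sum>\<mu>\<leftarrow>perp_spectrum k E. \<mu>\<^sup>2) = real d * (real k - real d)"
    and "\<And>\<mu>. \<mu> \<in> set (perp_spectrum k E) \<Longrightarrow> \<bar>\<mu>\<bar> \<le> real d"
proof -
  let ?B = "shifted_adj_mat k E"
  have B: "?B \<in> carrier_mat k k" by (rule shifted_adj_mat_carrier)
  obtain bs where jnf: "jordan_nf ?B (map (Pair 1) bs)"
    using symmetric_real_diagonalizable[OF B] by (auto simp: shifted_adj_mat_def insert_commute)
  have bound: "\<bar>\<mu>\<bar> \<le> real d" if "\<mu> \<in> perp_eigenvalues k E" for \<mu>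
    using that regular_graph_eigenvalue_bound[OF G] unfolding perp_eigenvalues_def by blast
  have mem: "\<mu> \<in> perp_eigenvalues k E \<longleftrightarrow> \<mu> \<in> set bs" if "\<mu> \<noteq> real d + 1" for \<mu>
  proof -
    have "\<mu> \<in> set bs \<longleftrightarrow> (\<exists>y\<in>mat_kernel (char_matrix ?B \<mu>). y \<noteq> 0\<^sub>v k)"
      unfolding diagonalizable_eigenvalue_iff[OF B jnf, symmetric] mat_kernel_char_matrix[OF B]
        eigenvalue_def eigenvector_def using B by auto
    also have "\<dots> \<longleftrightarrow> \<mu> \<in> perp_eigenvalues k E"
      unfolding perp_eigenspace_shifted[OF G k that, symmetric]
      by (auto simp: perp_eigenvalues_def perp_eigenspace_def eigenvector_def ones_perp_def adj_mat_def)
    finally show ?thesis by simp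
  qed
  have nmem: "real d + 1 \<notin> perp_eigenvalues k E" using bound by force
  have "perp_eigenvalues k E \<subseteq> set bs" by (metis mem nmem subsetI)
  hence fin: "finite (perp_eigenvalues k E)" using finite_subset by blast
  have mult: "perp_multiplicity k E \<mu> = count (mset bs) \<mu>" if "\<mu> \<noteq> real d + 1" for \<mu>
    unfolding diagonalizable_dim_eigenspace[OF jnf, symmetric] perp_multiplicity_def kernel_dim_def
      perp_eigenspace_shifted[OF G k that] carrier_matD(2)[OF char_matrix_closed[OF B]] ..
  have "mset bs = add_mset (real d + 1) (mset (perp_spectrum k E))"
  proof (rule multiset_eqI)
    fix \<mu>
    have c: "count (mset (perp_spectrum k E)) \<mu> = (if \<mu> \<in> perp_eigenvalues k E then perp_multiplicity k E \<mu> else 0)"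
      unfolding perp_spectrum_def using fin by (subst count_concat_replicate) auto
    show "count (mset bs) \<mu> = count (add_mset (real d + 1) (mset (perp_spectrum k E))) \<mu>"
    proof (cases "\<mu> = real d + 1")
      case True
      have "count (mset (perp_spectrum k E)) \<mu> = 0" unfolding c using nmem True by simp
      moreover have "count (mset bs) \<mu> = 1"
        using top_eigenspace_shifted[OF G k] diagonalizable_dim_eigenspace[OF jnf, of \<mu>] True by (simp only:)
      ultimately show ?thesis by (simp only: True count_add_mset if_True refl One_nat_def)
    next
      case False
      show ?thesis
      proof (cases "\<mu> \<in> set bs")
        case True
        thus ?thesis using c False mem[OF False] mult[OF False] by simp
      next
        case nb: False
        hence "count (mset bs) \<mu> = 0" by (simp add: count_eq_zero_iff)
        moreover have "count (mset (perp_spectrum k E)) \<mu> = 0" unfolding c using mem[OF False] nb by simp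
        ultimately show ?thesis using False by (metis count_add_mset)
      qed
    qed
  qed
  hence bs: "mset bs = mset ((real d + 1) # perp_spectrum k E)" by simp
  have sums: "sum_list (map f bs) = f (real d + 1) + sum_list (map f (perp_spectrum k E))" for f :: "real \<Rightarrow> real"
  proof -
    have "sum_list (map f bs) = sum_mset (image_mset f (mset bs))"
      by (metis mset_map sum_mset_sum_list)
    thus ?thesis unfolding bs by (simp add: sum_mset_sum_list[symmetric] del: sum_mset_sum_list)
  qed
  note powers = diagonalizable_power_sums[OF B jnf]
  have "length bs = Suc (length (perp_spectrum k E))"
    using bs by (metis length_Cons size_mset)
  thus "length (perp_spectrum k E) = k - 1" using powers(1) by simp
  have simple: "{i} \<notin> E" for i
    using G unfolding regular_graph_def simple_graph_def by force
  have "mat_trace ?B = 1"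
    using k by (simp add: mat_trace_def shifted_adj_mat_def simple)
  thus "sum_list (perp_spectrum k E) = - real d"
    using sums[of "\<lambda>x. x"] powers(2) by simp
  have "mat_trace (?B * ?B) = (\<Sum>i<k. \<Sum>j<k. ((if {i, j} \<in> E then 1 else 0) + 1 / real k)\<^sup>2)"
    by (simp add: mat_trace_def shifted_adj_mat_def scalar_prod_def lessThan_atLeast0 insert_commute power2_eq_square)
  also have "\<dots> = (\<Sum>i<k. \<Sum>j<k. (1 + 2 / real k) * (if {i, j} \<in> E then 1 else 0) + 1 / (real k)\<^sup>2)"
    by (intro sum.cong refl) (auto simp: power2_sum power_divide)
  also have "\<dots> = (\<Sum>i<k. (1 + 2 / real k) * real d + real k * (1 / (real k)\<^sup>2))"
    by (intro sum.cong refl)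
      (simp only: sum.distrib sum_distrib_left[symmetric] regular_graph_row_sum[OF G] lessThan_iff sum_constant card_lessThan)
  also have "\<dots> = real k * real d + 2 * real d + 1"
    using k by (simp add: field_simps power2_eq_square)
  finally show "(\<Sum>\<mu>\<leftarrow>perp_spectrum k E. \<mu>\<^sup>2) = real d * (real k - real d)"
    using sums[of "\<lambda>x. x\<^sup>2"] powers(3) by (simp add: algebra_simps power2_eq_square)
  show "\<bar>\<mu>\<bar> \<le> real d" if "\<mu> \<in> set (perp_spectrum k E)" for \<mu>
    using that bound fin unfolding perp_spectrum_def by auto
qed

section \<open>The quotients of q by I and their logarithms\<close>

text \<open>
  The difference of the two sides has derivative \<open>(t - 1) (1/m - 1/t)\<close>, which for \<open>t \<ge> m\<close> has the
  sign of \<open>t - 1\<close>, so the minimum is the value \<open>0\<close> at \<open>t = 1\<close>. Dividing by \<open>2 m\<close>, rather than by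
  \<open>m\<close> as the bound \<open>ln t \<ge> 1 - 1/t\<close> would give, is needed for the constant when \<open>\<lambda> > 1/3\<close>.
\<close>

lemma ln_quadratic_lower_bound:
  fixes m t :: real
  assumes m: "0 < m" "m \<le> 1" "m \<le> t"
  shows "(t - 1) - (t - 1)\<^sup>2 / (2 * m) \<le> ln t"
proof -
  define f where "f = (\<lambda>t. ln t + (1 - t) + (t - 1)\<^sup>2 / (2 * m))"
  have deriv: "(f has_real_derivative (t - 1) * (1 / m - 1 / t)) (at t)" if "m \<le> t" for t
    unfolding f_def using that m
    by (auto intro!: derivative_eq_intros simp: field_simps power2_eq_square)
  have "f 1 \<le> f t"
  proof (cases "1 \<le> t")
    case True
    show ?thesis
    proof (rule DERIV_nonneg_imp_nondecreasing[where f = f, OF True])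
      fix x assume "1 \<le> x" "x \<le> t"
      thus "\<exists>y. DERIV f x :> y \<and> 0 \<le> y"
        using deriv[of x] m by (intro exI conjI) (auto intro!: mult_nonneg_nonneg simp: frac_le)
    qed
  next
    case False
    show ?thesis
    proof (rule DERIV_nonpos_imp_nonincreasing[where f = f])
      show "t \<le> 1" using False by simp
      fix x assume "t \<le> x" "x \<le> 1"
      thus "\<exists>y. DERIV f x :> y \<and> y \<le> 0"
        using deriv[of x] m by (intro exI conjI) (auto intro!: mult_nonpos_nonneg simp: frac_le)
    qed
  qed
  thus ?thesis by (simp add: f_def)
qed

text \<open>
  The quotient \<open>q\<^sub>i / I\<close> as a function of the eigenvalue \<open>\<mu>\<^sub>i\<close>, with \<open>d = \<lambda> (k - 1)\<close> eliminated.
\<close>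

definition rel_q :: "nat \<Rightarrow> real \<Rightarrow> real \<Rightarrow> real" where
  "rel_q k l \<mu> = 1 + ((1 - 2 * l) / (l * (1 - l)) * \<mu> - 1 / (1 - l)) / real k"

lemma q_spec_over_I_spec:
  assumes k: "2 \<le> k" and l: "0 < edge_density k d" "edge_density k d < 1"
  shows "q_spec k d E i / I_spec k d = rel_q k (edge_density k d) (mu k E i)"
proof -
  define l n m where "l = edge_density k d" and "n = real k - 1" and "m = mu k E i"
  have n: "n > 0" "real k = n + 1" using k by (auto simp: n_def)
  have d: "real d = l * n" using k by (simp add: l_def edge_density_def n_def)
  have l01: "0 < l" "1 - l \<noteq> 0" "l \<noteq> 0" using l by (auto simp: l_def)
  have "q_spec k d E i = 1 / 8 * (l * n / l\<^sup>2 + (n - 1 - l * n) / (1 - l)\<^sup>2 + (1 / l\<^sup>2 - 1 / (1 - l)\<^sup>2) * m)"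
    unfolding q_spec_def Let_def l_def[symmetric] m_def[symmetric] d n(2) by simp
  also have "\<dots> = (n + 1) / (8 * l * (1 - l)) * (1 + ((1 - 2 * l) / (l * (1 - l)) * m - 1 / (1 - l)) / (n + 1))"
    using l01 n(1) by (simp add: divide_simps add_nonneg_eq_0_iff) (simp add: power2_eq_square algebra_simps)
  also have "\<dots> = I_spec k d * rel_q k l m"
    unfolding I_spec_def Let_def l_def[symmetric] rel_q_def n(2) by simp
  finally show ?thesis
    using l01 n by (simp add: I_spec_def Let_def l_def m_def)
qed

lemma sum_list_affine_powers:
  fixes a b :: real
  shows "(\<Sum>x\<leftarrow>xs. a * x + b) = a * sum_list xs + b * length xs"
    and "(\<Sum>x\<leftarrow>xs. (a * x + b)\<^sup>2) = a\<^sup>2 * (\<Sum>x\<leftarrow>xs. x\<^sup>2) + 2 * a * b * sum_list xs + b\<^sup>2 * length xs"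
  by (induction xs) (simp_all add: algebra_simps power2_eq_square)

text \<open>
  In the first moment the contributions of the eigenvalue sum and of the constant term add up to
  \<open>- (k - 1)/k\<close> times \<open>((1 - 2 \<lambda>) + 1) / (1 - \<lambda>) = 2\<close>, so the dependence on \<open>\<lambda>\<close> cancels.
\<close>

lemma rel_q_deviation_moments:
  fixes ms :: "real list"
  assumes k: "2 \<le> k" and l: "0 < l" "l < 1"
    and len: "length ms = k - 1" and s1: "sum_list ms = - (l * (real k - 1))"
    and s2: "(\<Sum>\<mu>\<leftarrow>ms. \<mu>\<^sup>2) = l * (real k - 1) * (real k - l * (real k - 1))"
  shows "(\<Sum>\<mu>\<leftarrow>ms. rel_q k l \<mu> - 1) = - 2 * (real k - 1) / real k"
    and "(\<Sum>\<mu>\<leftarrow>ms. (rel_q k l \<mu> - 1)\<^sup>2)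
      = ((real k - 1)\<^sup>2 * (1 - 2 * l)\<^sup>2 + (real k - 1)) / ((real k)\<^sup>2 * l * (1 - l))"
proof -
  define n where "n = real k - 1"
  define a b where "a = (1 - 2 * l) / (l * (1 - l) * (n + 1))" and "b = - 1 / ((1 - l) * (n + 1))"
  have n: "n > 0" "real k = n + 1" "real (length ms) = n" "n + 1 \<noteq> 0" using k len by (auto simp: n_def)
  have l': "l \<noteq> 0" "1 - l \<noteq> 0" using l by auto
  have x: "rel_q k l \<mu> - 1 = a * \<mu> + b" for \<mu>
    using l' n(4) unfolding rel_q_def a_def b_def n(2) by (simp add: divide_simps)
  have "a * (- (l * n)) + b * n = - 2 * n / (n + 1)"
    using l' n(4) unfolding a_def b_def by (simp add: divide_simps) (simp add: algebra_simps)
  thus "(\<Sum>\<mu>\<leftarrow>ms. rel_q k l \<mu> - 1) = - 2 * (real k - 1) / real k"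
    unfolding x sum_list_affine_powers s1 n(3) n(2) by simp
  have "a\<^sup>2 * (l * n * (n + 1 - l * n)) + 2 * a * b * (- (l * n)) + b\<^sup>2 * n
      = (n\<^sup>2 * (1 - 2 * l)\<^sup>2 + n) / ((n + 1)\<^sup>2 * l * (1 - l))"
    using l' n(4) unfolding a_def b_def by (simp add: divide_simps) (simp add: power2_eq_square algebra_simps)
  thus "(\<Sum>\<mu>\<leftarrow>ms. (rel_q k l \<mu> - 1)\<^sup>2)
      = ((real k - 1)\<^sup>2 * (1 - 2 * l)\<^sup>2 + (real k - 1)) / ((real k)\<^sup>2 * l * (1 - l))"
    unfolding x sum_list_affine_powers s1 s2 n(3) n(2) by simp
qed

text \<open>
  As \<open>\<lambda> \<le> 1/2\<close>, the affine function \<open>rel_q\<close> is nondecreasing, and the left-hand side is its value at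
  \<open>\<mu> = - d\<close>.
\<close>

lemma rel_q_lower_bound:
  assumes k: "2 \<le> k" and l: "0 < l" "l \<le> 1 / 2" and \<mu>: "- (l * (real k - 1)) \<le> \<mu>"
  shows "l * (real k - 2) / (real k * (1 - l)) \<le> rel_q k l \<mu>"
proof -
  have "l * (real k - 2) / (real k * (1 - l)) = rel_q k l (- (l * (real k - 1)))"
    using k l by (simp add: rel_q_def divide_simps) (simp add: algebra_simps)
  also have "\<dots> \<le> rel_q k l \<mu>"
    unfolding rel_q_def using \<mu> k l
    by (intro add_left_mono divide_right_mono diff_right_mono mult_left_mono) auto
  finally show ?thesis .
qed

lemma F_spec_eq_exp:
  assumes k: "2 \<le> k" and l: "0 < edge_density k d" "edge_density k d < 1"
    and len: "length (perp_spectrum k E) = k - 1"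
    and pos: "\<And>\<mu>. \<mu> \<in> set (perp_spectrum k E) \<Longrightarrow> 0 < rel_q k (edge_density k d) \<mu>"
  shows "F_spec k d E = exp (- (\<Sum>\<mu>\<leftarrow>perp_spectrum k E. ln (rel_q k (edge_density k d) \<mu>)) / 2)"
proof -
  let ?t = "rel_q k (edge_density k d)"
  have "F_spec k d E = (\<Prod>i = 2..k. exp (- ln (?t (mu k E i)) / 2))"
    unfolding F_spec_def
  proof (rule prod.cong[OF refl])
    fix i assume "i \<in> {2..k}"
    hence "mu k E i \<in> set (perp_spectrum k E)" unfolding mu_def using len by (intro nth_mem) auto
    hence t: "0 < ?t (mu k E i)" by (rule pos)
    have "I_spec k d / q_spec k d E i = inverse (?t (mu k E i))"
      unfolding q_spec_over_I_spec[OF k l, symmetric] by simp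
    thus "(I_spec k d / q_spec k d E i) powr (1 / 2) = exp (- ln (?t (mu k E i)) / 2)"
      using t by (simp add: powr_def ln_inverse)
  qed
  also have "\<dots> = exp (\<Sum>i = 2..k. - ln (?t (mu k E i)) / 2)" by (simp add: exp_sum)
  also have "(\<Sum>i = 2..k. - ln (?t (mu k E i)) / 2) = - (\<Sum>i = 2..k. ln (?t (mu k E i))) / 2"
    by (simp only: sum_divide_distrib[symmetric] sum_negf)
  also have "(\<Sum>i = 2..k. ln (?t (mu k E i))) = (\<Sum>i<k - 1. ln (?t (perp_spectrum k E ! i)))"
    unfolding mu_def by (rule sum.reindex_bij_witness[of _ "\<lambda>i. i + 2" "\<lambda>i. i - 2"]) auto
  also have "\<dots> = (\<Sum>\<mu>\<leftarrow>perp_spectrum k E. ln (?t \<mu>))"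
    by (simp add: sum_list_sum_nth len lessThan_atLeast0)
  finally show ?thesis .
qed

text \<open>
  The identity \<open>(k - 1)\<^sup>2 = k (k - 2) + 1\<close> splits the quotient into the main term
  \<open>(1 - 2 \<lambda>)\<^sup>2 / (4 \<lambda>\<^sup>2)\<close> and a remainder of order \<open>1 / (\<lambda>\<^sup>2 k)\<close>.
\<close>

lemma second_order_term_bound:
  fixes k l :: real
  assumes k: "6 \<le> k" and l: "0 < l" "l \<le> 1 / 2"
  shows "(k - 1) / k + ((k - 1)\<^sup>2 * (1 - 2 * l)\<^sup>2 + (k - 1)) / (k\<^sup>2 * l * (1 - l)) / (4 * (l * (k - 2) / (k * (1 - l))))
    \<le> 1 + (1 - l) * (1 - 2 * l)\<^sup>2 / (4 * l ^ 3) + 1 / (l ^ 3 * k)"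
proof -
  have nz: "k \<noteq> 0" "k - 2 \<noteq> 0" "l \<noteq> 0" "1 - l \<noteq> 0" using k l by auto
  define s where "s = (1 - 2 * l)\<^sup>2"
  have s: "0 \<le> s" "s \<le> 1" using l by (auto simp: s_def power_le_one)
  have "((k - 1)\<^sup>2 * s + (k - 1)) / (k\<^sup>2 * l * (1 - l)) / (4 * (l * (k - 2) / (k * (1 - l))))
      = s / (4 * l\<^sup>2) + (s + (k - 1)) / (4 * l\<^sup>2 * k * (k - 2))"
    using nz by (simp add: divide_simps) (simp add: power2_eq_square algebra_simps)
  moreover have "s / (4 * l\<^sup>2) \<le> (1 - l) * s / (4 * l ^ 3)"
  proof -
    have "s / (4 * l\<^sup>2) = l * s / (4 * l ^ 3)" using nz by (simp add: power2_eq_square power3_eq_cube)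
    also have "\<dots> \<le> (1 - l) * s / (4 * l ^ 3)"
      using l s by (intro divide_right_mono mult_right_mono) auto
    finally show ?thesis .
  qed
  moreover have "(s + (k - 1)) / (4 * l\<^sup>2 * k * (k - 2)) \<le> 1 / (l ^ 3 * k)"
  proof -
    have "(s + (k - 1)) / (4 * l\<^sup>2 * k * (k - 2)) \<le> k / (4 * l\<^sup>2 * k * (k - 2))"
      using s k l by (intro divide_right_mono) auto
    also have "\<dots> = l * k / (4 * (k - 2)) / (l ^ 3 * k)"
      using nz by (simp add: divide_simps) (simp add: power2_eq_square power3_eq_cube)
    also have "\<dots> \<le> 1 / (l ^ 3 * k)"
    proof (rule divide_right_mono)
      have "l * k \<le> 1 * k" using l k by (intro mult_right_mono) auto
      also have "1 * k \<le> 4 * (k - 2)" using k by simp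
      finally show "l * k / (4 * (k - 2)) \<le> 1" using k by simp
    qed (use l k in auto)
    finally show ?thesis .
  qed
  moreover have "(k - 1) / k \<le> 1" using k by simp
  ultimately show ?thesis unfolding s_def by linarith
qed

section \<open>The bounds on the spectral factor\<close>

lemma F_spec_bounds:
  assumes k: "6 \<le> k" and d: "1 \<le> d" "real d \<le> (real k - 1) / 2" and G: "regular_graph k d E"
    and l_def: "l = edge_density k d"
  shows "1 < F_spec k d E"
    and "F_spec k d E \<le> exp (1 + (1 - l) * (1 - 2 * l)\<^sup>2 / (4 * l ^ 3) + 1 / (l ^ 3 * real k))"
proof -
  let ?ms = "perp_spectrum k E" and ?t = "rel_q k l"
  have dl: "real d = l * (real k - 1)" using k by (simp add: l_def edge_density_def)
  have "0 < l" using k d(1) by (simp add: l_def edge_density_def)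
  moreover have "l \<le> 1 / 2" using k d(2) by (simp add: l_def edge_density_def divide_simps)
  ultimately have l: "0 < l" "l \<le> 1 / 2" "l < 1" by auto
  have k2: "2 \<le> k" "0 < k" using k by auto
  note spec = regular_graph_perp_spectrum[OF G k2(2)]
  note dev = rel_q_deviation_moments[OF k2(1) l(1,3) spec(1) spec(2,3)[unfolded dl]]
  define m where "m = l * (real k - 2) / (real k * (1 - l))"
  have m0: "0 < m" using k l by (simp add: m_def)
  have "l * (real k - 2) \<le> (1 - l) * real k" using k l by (intro mult_mono) auto
  hence m1: "m \<le> 1" using k l by (simp add: m_def divide_simps mult.commute)
  have mt: "m \<le> ?t \<mu>" if "\<mu> \<in> set ?ms" for \<mu>
    unfolding m_def using spec(4)[OF that] dl by (intro rel_q_lower_bound[OF k2(1) l(1,2)]) linarith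
  define S where "S = (\<Sum>\<mu>\<leftarrow>?ms. ln (?t \<mu>))"
  have F: "F_spec k d E = exp (- S / 2)"
    unfolding S_def l_def
  proof (rule F_spec_eq_exp[OF k2(1) l(1,3)[unfolded l_def] spec(1)])
    show "0 < rel_q k (edge_density k d) \<mu>" if "\<mu> \<in> set ?ms" for \<mu>
      using mt[OF that] m0 unfolding l_def by linarith
  qed
  have "S \<le> (\<Sum>\<mu>\<leftarrow>?ms. ?t \<mu> - 1)"
    unfolding S_def using mt m0 by (intro sum_list_mono ln_le_minus_one) fastforce
  also have "\<dots> < 0" unfolding dev(1) using k by (simp add: divide_simps)
  finally show "1 < F_spec k d E" unfolding F by simp
  have "(\<Sum>\<mu>\<leftarrow>?ms. (?t \<mu> - 1) - (?t \<mu> - 1)\<^sup>2 / (2 * m)) \<le> S"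
    unfolding S_def using mt m0 m1 by (intro sum_list_mono ln_quadratic_lower_bound)
  moreover have "(\<Sum>\<mu>\<leftarrow>ms. (?t \<mu> - 1) - (?t \<mu> - 1)\<^sup>2 / (2 * m))
      = (\<Sum>\<mu>\<leftarrow>ms. ?t \<mu> - 1) - (\<Sum>\<mu>\<leftarrow>ms. (?t \<mu> - 1)\<^sup>2) / (2 * m)" for ms
    by (induction ms) (simp_all add: add_divide_distrib)
  ultimately have "(\<Sum>\<mu>\<leftarrow>?ms. ?t \<mu> - 1) - (\<Sum>\<mu>\<leftarrow>?ms. (?t \<mu> - 1)\<^sup>2) / (2 * m) \<le> S"
    by (simp only:)
  moreover have "- S / 2 \<le> - X / 2 + Z / 2" if "X - Z \<le> S" for X Z
    using that by linarith
  ultimately have "- S / 2 \<le> - (\<Sum>\<mu>\<leftarrow>?ms. ?t \<mu> - 1) / 2 + (\<Sum>\<mu>\<leftarrow>?ms. (?t \<mu> - 1)\<^sup>2) / (2 * m) / 2"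
    by blast
  also have "\<dots> = (real k - 1) / real k
      + ((real k - 1)\<^sup>2 * (1 - 2 * l)\<^sup>2 + (real k - 1)) / ((real k)\<^sup>2 * l * (1 - l)) / (4 * m)"
  proof -
    have "- (- 2 * a / c) / 2 + Y / (2 * m) / 2 = a / c + Y / (4 * m)" for a c Y :: real
      by simp
    thus ?thesis unfolding dev .
  qed
  also have "\<dots> \<le> 1 + (1 - l) * (1 - 2 * l)\<^sup>2 / (4 * l ^ 3) + 1 / (l ^ 3 * real k)"
    unfolding m_def using k by (intro second_order_term_bound l) simp
  finally show "F_spec k d E \<le> exp (1 + (1 - l) * (1 - 2 * l)\<^sup>2 / (4 * l ^ 3) + 1 / (l ^ 3 * real k))"
    unfolding F by simp
qed

theorem proposition3p6:
  shows "(\<exists>C::real. \<forall>(k::nat) (d::nat) (E :: nat set set).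
            6 \<le> k \<longrightarrow> 1 \<le> d \<longrightarrow> real d \<le> (real k - 1) / 2 \<longrightarrow> regular_graph k d E \<longrightarrow>
            (let l = edge_density k d in
               1 < F_spec k d E \<and>
               F_spec k d E \<le>
                 exp (1 + (1 - l) * (1 - 2 * l)\<^sup>2 / (4 * l ^ 3) + C / (l ^ 3 * real k)))) \<and>
         (\<forall>l0::real. 0 < l0 \<longrightarrow>
            (\<exists>B::real. \<forall>(k::nat) (d::nat) (E :: nat set set).
               6 \<le> k \<longrightarrow> 1 \<le> d \<longrightarrow> real d \<le> (real k - 1) / 2 \<longrightarrow> regular_graph k d E \<longrightarrow>
               l0 \<le> edge_density k d \<longrightarrow> F_spec k d E \<le> B))"
proof (intro conjI)
  show "\<exists>C::real. \<forall>(k::nat) (d::nat) (E :: nat set set).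
            6 \<le> k \<longrightarrow> 1 \<le> d \<longrightarrow> real d \<le> (real k - 1) / 2 \<longrightarrow> regular_graph k d E \<longrightarrow>
            (let l = edge_density k d in
               1 < F_spec k d E \<and>
               F_spec k d E \<le>
                 exp (1 + (1 - l) * (1 - 2 * l)\<^sup>2 / (4 * l ^ 3) + C / (l ^ 3 * real k)))"
    unfolding Let_def using F_spec_bounds[OF _ _ _ _ refl] by (intro exI[of _ 1]) blast
  show "\<forall>l0::real. 0 < l0 \<longrightarrow>
            (\<exists>B::real. \<forall>(k::nat) (d::nat) (E :: nat set set).
               6 \<le> k \<longrightarrow> 1 \<le> d \<longrightarrow> real d \<le> (real k - 1) / 2 \<longrightarrow> regular_graph k d E \<longrightarrow>
               l0 \<le> edge_density k d \<longrightarrow> F_spec k d E \<le> B)"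
  proof (intro allI impI exI)
    fix l0 :: real and k d :: nat and E :: "nat set set"
    assume l0: "0 < l0" and k: "6 \<le> k" and d: "1 \<le> d" "real d \<le> (real k - 1) / 2"
      and G: "regular_graph k d E" and le: "l0 \<le> edge_density k d"
    define l where "l = edge_density k d"
    have l: "l0 \<le> l" "0 < l"
      using le l0 by (auto simp: l_def)
    have l_half: "l \<le> 1 / 2"
      using k d(2) by (simp add: l_def edge_density_def divide_simps)
    have cube: "l0 ^ 3 \<le> l ^ 3" "0 < l0 ^ 3" using l l0 by (auto intro: power_mono)
    have "(1 - l) * (1 - 2 * l)\<^sup>2 \<le> 1 * 1"
      using l l_half by (intro mult_mono power_le_one) auto
    hence "(1 - l) * (1 - 2 * l)\<^sup>2 / (4 * l ^ 3) \<le> 1 / (4 * l0 ^ 3)"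
      using cube l by (intro frac_le) auto
    moreover have "1 / (l ^ 3 * real k) \<le> 1 / (l0 ^ 3 * 1)"
      using cube k l0 l by (intro frac_le mult_mono) auto
    ultimately have "1 + (1 - l) * (1 - 2 * l)\<^sup>2 / (4 * l ^ 3) + 1 / (l ^ 3 * real k)
        \<le> 1 + 1 / (4 * l0 ^ 3) + 1 / (l0 ^ 3 * 1)"
      by linarith
    with F_spec_bounds(2)[OF k d G l_def]
    show "F_spec k d E \<le> exp (1 + 1 / (4 * l0 ^ 3) + 1 / (l0 ^ 3 * 1))"
      by (meson exp_le_cancel_iff order_trans)
  qed
qed

end
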